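(* Let $D=(V,A)$ be a finite connected directed acyclic graph, and let $M$ be the coefficient matrix, with columns indexed by the variables $k$ and $f(v)$ ($v\in V$), of the system of constraints $$\sum_{w\in N(v)}f(w)-\sum_{w\in N(u)}f(w)\ge 1\quad\text{for all }(u,v)\in A,\qquad\qquad k-f(v)\ge 0\quad\text{for all }v\in V$$ (one row per constraint). Then $M$ is totally unimodular if and only if the undirected underlying graph $G(D)$ of $D$ is a complete graph.
   Context: For a directed acyclic graph $D=(V,A)$, $G(D)$ denotes its undirected underlying graph and $N(v)$ denotes the set of neighbors of $v$ in $G(D)$ (both in- and out-neighbors). Thus the row of $M$ for an arc $(u,v)$ has coefficient $[x\in N(v)]-[x\in N(u)]$ in the column of $f(x)$ (where $[\cdot]$ is $1$ if the condition holds and $0$ otherwise) and $0$ in the column of $k$; the row of $M$ for a vertex $v$ has $1$ in the column of $k$, $-1$ in the column of $f(v)$, and $0$ elsewhere. A matrix is totally unimodular if every square submatrix has determinant in $\{-1,0,1\}$. *)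

theory Defs
  imports Graph_Theory.Kuratowski Jordan_Normal_Form.Determinant
begin

text \<open>
  Matrices are functions with explicit finite sets \<open>R\<close> of row indices and \<open>C\<close> of column indices.
  A square submatrix is given by listing its rows and columns without repetition; listing them in
  another order changes the determinant at most by a sign, to which \<open>{-1, 0, 1}\<close> is insensitive.
\<close>

definition totally_unimodular :: "'r set \<Rightarrow> 'c set \<Rightarrow> ('r \<Rightarrow> 'c \<Rightarrow> int) \<Rightarrow> bool" where
  "totally_unimodular R C M \<longleftrightarrow>
     (\<forall>rs cs. distinct rs \<and> set rs \<subseteq> R \<and> distinct cs \<and> set cs \<subseteq> C \<and> length rs = length cs \<longrightarrow>
        det (mat (length rs) (length cs) (\<lambda>(i, j). M (rs ! i) (cs ! j))) \<in> {-1, 0, 1})"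

definition neighbors :: "'v pair_pre_digraph \<Rightarrow> 'v \<Rightarrow> 'v set" where
  "neighbors D v = {w. (v, w) \<in> parcs (mk_symmetric D)}"

datatype 'v lp_var = Var_k | Var_f 'v

datatype 'v lp_constr = Arc_constr "'v \<times> 'v" | Vert_constr 'v

definition lp_vars :: "'v pair_pre_digraph \<Rightarrow> 'v lp_var set" where
  "lp_vars D = insert Var_k (Var_f ` pverts D)"

definition lp_constrs :: "'v pair_pre_digraph \<Rightarrow> 'v lp_constr set" where
  "lp_constrs D = Arc_constr ` parcs D \<union> Vert_constr ` pverts D"

fun lp_matrix :: "'v pair_pre_digraph \<Rightarrow> 'v lp_constr \<Rightarrow> 'v lp_var \<Rightarrow> int" where
  "lp_matrix D (Arc_constr (u, v)) Var_k = 0"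
| "lp_matrix D (Arc_constr (u, v)) (Var_f x) =
     of_bool (x \<in> neighbors D v) - of_bool (x \<in> neighbors D u)"
| "lp_matrix D (Vert_constr v) Var_k = 1"
| "lp_matrix D (Vert_constr v) (Var_f x) = (if x = v then -1 else 0)"

text \<open>
  The next two lemmas confirm that \<open>lp_matrix D\<close> holds the coefficients of the left-hand sides of
  the constraints \<open>(\<Sum>w\<in>N(v). f w) - (\<Sum>w\<in>N(u). f w) \<ge> 1\<close> for arcs \<open>(u, v)\<close> and
  \<open>k - f v \<ge> 0\<close> for vertices \<open>v\<close>.
\<close>

lemma sum_lp_vars:
  assumes "finite (pverts D)"
  shows "(\<Sum>c\<in>lp_vars D. g c) = g Var_k + (\<Sum>x\<in>pverts D. g (Var_f x) :: int)"
proof -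
  have "Var_k \<notin> Var_f ` pverts D" "inj_on Var_f (pverts D)" by (auto simp: inj_on_def)
  then show ?thesis
    using assms by (simp add: lp_vars_def sum.reindex)
qed

lemma (in pair_wf_digraph) neighbors_subset: "neighbors G v \<subseteq> pverts G"
  by (auto simp: neighbors_def mk_symmetric_def dest: in_arcsD1 in_arcsD2)

lemma lp_matrix_Arc_constr:
  fixes y :: "'v lp_var \<Rightarrow> int"
  assumes "pair_fin_digraph D"
  shows "(\<Sum>c\<in>lp_vars D. lp_matrix D (Arc_constr (u, v)) c * y c) =
    (\<Sum>w\<in>neighbors D v. y (Var_f w)) - (\<Sum>w\<in>neighbors D u. y (Var_f w))"
proof -
  interpret pair_fin_digraph D by fact
  have fin: "finite (pverts D)" by (rule pair_finite_verts)
  have *: "(\<Sum>x\<in>pverts D. of_bool (x \<in> neighbors D z) * y (Var_f x)) =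
      (\<Sum>w\<in>neighbors D z. y (Var_f w))" for z
  proof -
    have "(\<Sum>w\<in>neighbors D z. y (Var_f w)) =
        (\<Sum>x\<in>pverts D. of_bool (x \<in> neighbors D z) * y (Var_f x))"
      by (rule sum.mono_neutral_cong_left[OF fin neighbors_subset]) auto
    then show ?thesis by simp
  qed
  show ?thesis
    by (simp add: sum_lp_vars[OF fin] left_diff_distrib sum_subtractf * del: sum_of_bool_mult_eq)
qed

lemma lp_matrix_Vert_constr:
  fixes y :: "'v lp_var \<Rightarrow> int"
  assumes "finite (pverts D)" "v \<in> pverts D"
  shows "(\<Sum>c\<in>lp_vars D. lp_matrix D (Vert_constr v) c * y c) = y Var_k - y (Var_f v)"
proof -
  have "(\<Sum>x\<in>pverts D. (if x = v then -1 else 0) * y (Var_f x)) =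
      (\<Sum>x\<in>pverts D. if x = v then - y (Var_f x) else 0)"
    by (rule sum.cong) auto
  then show ?thesis
    using assms by (simp add: sum_lp_vars)
qed

end

(* For a complete graph every row of the matrix has exactly one entry 1 and one entry -1, so the
   matrix is the transpose of the incidence matrix of a digraph, and such matrices are totally
   unimodular: in a square submatrix either all row sums vanish, or some row has at most one nonzero
   entry and Laplace expansion along it reduces the size. If the graph is connected but not complete,
   it has an induced path a - b - c, and the rows of an arc joining a and b, of the vertex a and of the
   vertex c, restricted to the columns f(a), f(c), k, have determinant 2 or -2. *)

theory Submission
  imports Defs
begin

text \<open>Cofactor expansion along the first row, in the form that evaluates the submatrix coming
  from an induced path.\<close>

lemma det_3:
  "det (mat 3 3 f) = f (0,0) * (f (1,1) * f (2,2) - f (1,2) * f (2,1))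
     - f (0,1) * (f (1,0) * f (2,2) - f (1,2) * f (2,0))
     + f (0,2) * (f (1,0) * f (2,1) - (f (1,1) * f (2,0) :: 'a :: comm_ring_1))"
proof -
  have det_2: "det (mat 2 2 g) = g (0,0) * g (1,1) - (g (0,1) * g (1,0) :: 'a)" for g
    by (subst laplace_expansion_row[of _ 2 0])
      (auto simp: numeral_2_eq_2 cofactor_def mat_delete_def det_single)
  show ?thesis
    by (subst laplace_expansion_row[of _ 3 0])
      (auto simp: numeral_3_eq_3 cofactor_def mat_delete_def det_2[unfolded numeral_2_eq_2]
        numeral_2_eq_2 algebra_simps)
qed

text \<open>The last hypothesis forbids a nonzero value to repeat in a row, so a row has at most one
  1 and at most one -1. Unlike "exactly one of each", this survives the deletion of rows and columns
  that the induction performs.\<close>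

lemma det_one_pos_one_neg_per_row:
  fixes A :: "int mat"
  assumes "A \<in> carrier_mat n n"
    and "\<And>i j. i < n \<Longrightarrow> j < n \<Longrightarrow> A $$ (i, j) \<in> {-1, 0, 1}"
    and "\<And>i j k. i < n \<Longrightarrow> j < n \<Longrightarrow> k < n \<Longrightarrow> A $$ (i, j) = A $$ (i, k) \<Longrightarrow> A $$ (i, j) \<noteq> 0 \<Longrightarrow> j = k"
  shows "det A \<in> {-1, 0, 1}"
  using assms
proof (induction n arbitrary: A)
  case 0
  then show ?case by simp
next
  case (Suc n)
  show ?case
  \<comment> \<open>The first case is a row \<open>i\<close> vanishing outside some column
    \<open>j\<close>; a zero row is included.\<close>
  proof (cases "\<exists>i<Suc n. \<exists>j<Suc n. \<forall>k<Suc n. k \<noteq> j \<longrightarrow> A $$ (i, k) = 0")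
    case True
    then obtain i j where ij: "i < Suc n" "j < Suc n"
      and zero: "\<And>k. k < Suc n \<Longrightarrow> k \<noteq> j \<Longrightarrow> A $$ (i, k) = 0" by blast
    let ?B = "mat_delete A i j"
    have B: "?B $$ (k, l) = A $$ (insert_index i k, insert_index j l)" if "k < n" "l < n" for k l
      using mat_delete_index[OF Suc.prems(1) ij that] by simp
    have less: "insert_index i k < Suc n" if "k < n" for i k
      using that by (simp add: insert_index_def)
    \<comment> \<open>A row of the minor is a row of \<open>A\<close> without its entry in column
      \<open>j\<close>; injectivity of \<open>insert_index j\<close> keeps distinct columns
      distinct, so the hypothesis on repetitions carries over.\<close>
    have inj: "k = l" if "insert_index j k = insert_index j l" for k l
      using that by (auto simp: insert_index_def split: if_splits)
    have "det ?B \<in> {-1, 0, 1}"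
    proof (rule Suc.IH)
      show "?B \<in> carrier_mat n n" by (rule mat_delete_carrier[OF Suc.prems(1), simplified])
    next
      fix k l assume "k < n" "l < n"
      then show "?B $$ (k, l) \<in> {-1, 0, 1}"
        using Suc.prems(2) less by (simp only: B)
    next
      fix k l m assume "k < n" "l < n" "m < n" "?B $$ (k, l) = ?B $$ (k, m)" "?B $$ (k, l) \<noteq> 0"
      then show "l = m"
        using Suc.prems(3) less inj by (metis B)
    qed
    moreover have "det A = A $$ (i, j) * cofactor A i j"
    proof -
      have "det A = (\<Sum>k<Suc n. A $$ (i, k) * cofactor A i k)"
        by (rule laplace_expansion_row[OF Suc.prems(1) ij(1)])
      also have "\<dots> = (\<Sum>k\<in>{j}. A $$ (i, k) * cofactor A i k)"
        using ij(2) by (intro sum.mono_neutral_right) (auto simp: zero)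
      finally show ?thesis by simp
    qed
    moreover have "A $$ (i, j) \<in> {-1, 0, 1}" by (rule Suc.prems(2)[OF ij])
    moreover have "(-1 :: int) ^ (i + j) \<in> {-1, 1}" by (cases "even (i + j)") simp_all
    ultimately show ?thesis by (auto simp: cofactor_def)
  next
    case False
    \<comment> \<open>Every row now has two nonzero entries. They cannot be equal, so they are 1 and
      -1, and a third nonzero entry would repeat one of them.\<close>
    have sum0: "(\<Sum>k<Suc n. A $$ (i, k)) = 0" if i: "i < Suc n" for i
    proof -
      obtain j where j: "j < Suc n" "A $$ (i, j) \<noteq> 0" using False i by blast
      obtain k where k: "k < Suc n" "k \<noteq> j" "A $$ (i, k) \<noteq> 0" using False i j by blast
      have opp: "A $$ (i, j) + A $$ (i, k) = 0"
        using Suc.prems(2)[OF i j(1)] Suc.prems(2)[OF i k(1)] Suc.prems(3)[OF i j(1) k(1)] j k by auto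
      have "A $$ (i, l) = 0" if "l < Suc n" "l \<noteq> j" "l \<noteq> k" for l
        using Suc.prems(2)[OF i j(1)] Suc.prems(2)[OF i k(1)] Suc.prems(2)[OF i that(1)]
          Suc.prems(3)[OF i that(1) j(1)] Suc.prems(3)[OF i that(1) k(1)] opp that j k by auto
      then have "(\<Sum>k<Suc n. A $$ (i, k)) = (\<Sum>l\<in>{j, k}. A $$ (i, l))"
        using j k by (intro sum.mono_neutral_right) auto
      also have "\<dots> = 0" using k opp by simp
      finally show ?thesis .
    qed
    \<comment> \<open>Vanishing row sums put the all-ones vector into the kernel; it is nonzero
      because the dimension is \<open>Suc n\<close>.\<close>
    let ?v = "vec (Suc n) (\<lambda>_. 1 :: int)"
    have "A *\<^sub>v ?v = 0\<^sub>v (Suc n)"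
    proof (rule eq_vecI)
      fix i assume "i < dim_vec (0\<^sub>v (Suc n) :: int vec)"
      then show "(A *\<^sub>v ?v) $ i = 0\<^sub>v (Suc n) $ i"
        using sum0[of i] Suc.prems(1) by (simp add: scalar_prod_def atLeast0LessThan)
    qed (use Suc.prems(1) in simp)
    moreover have "?v \<noteq> 0\<^sub>v (Suc n)"
    proof
      assume "?v = 0\<^sub>v (Suc n)"
      then have "?v $ 0 = 0\<^sub>v (Suc n) $ 0" by (rule arg_cong)
      then show False by simp
    qed
    ultimately have "det A = 0"
      using det_0_iff_vec_prod_zero[OF Suc.prems(1)] by (metis vec_carrier)
    then show ?thesis by simp
  qed
qed

text \<open>Both hypotheses concern one row at a time, so every square submatrix inherits them;
  distinctness of \<open>cs\<close> turns equal column labels into equal positions.\<close>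

lemma totally_unimodularI:
  assumes "\<And>r c. r \<in> R \<Longrightarrow> c \<in> C \<Longrightarrow> M r c \<in> {-1, 0, 1}"
    and "\<And>r c d. r \<in> R \<Longrightarrow> c \<in> C \<Longrightarrow> d \<in> C \<Longrightarrow> M r c = M r d \<Longrightarrow> M r c \<noteq> 0 \<Longrightarrow> c = d"
  shows "totally_unimodular R C M"
  unfolding totally_unimodular_def
proof (intro allI impI)
  fix rs cs
  assume *: "distinct rs \<and> set rs \<subseteq> R \<and> distinct cs \<and> set cs \<subseteq> C \<and> length rs = length cs"
  have R: "rs ! i \<in> R" if "i < length cs" for i using * that by (metis nth_mem subsetD)
  have C: "cs ! i \<in> C" if "i < length cs" for i using * that by auto
  show "det (mat (length rs) (length cs) (\<lambda>(i, j). M (rs ! i) (cs ! j))) \<in> {-1, 0, 1}"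
  proof (rule det_one_pos_one_neg_per_row[where n = "length cs"])
    fix i j k
    assume "i < length cs" "j < length cs" "k < length cs"
      "mat (length rs) (length cs) (\<lambda>(i, j). M (rs ! i) (cs ! j)) $$ (i, j) =
       mat (length rs) (length cs) (\<lambda>(i, j). M (rs ! i) (cs ! j)) $$ (i, k)"
      "mat (length rs) (length cs) (\<lambda>(i, j). M (rs ! i) (cs ! j)) $$ (i, j) \<noteq> 0"
    then have "cs ! j = cs ! k"
      using * by (intro assms(2)[OF R[of i] C[of j] C[of k]]) auto
    then show "j = k" using * \<open>j < _\<close> \<open>k < _\<close> by (simp add: nth_eq_iff_index_eq)
  qed (use * R C assms(1) in auto)
qed

lemma mem_neighbors_iff: "w \<in> neighbors D v \<longleftrightarrow> (v, w) \<in> parcs D \<or> (w, v) \<in> parcs D"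
  by (auto simp: neighbors_def parcs_mk_symmetric intro: rev_bexI)

lemma complete_mk_symmetric_iff:
  assumes "pair_fin_digraph D"
  shows "complete_digraph (card (pverts D)) (with_proj (mk_symmetric (with_proj D))) \<longleftrightarrow>
    (\<forall>u\<in>pverts D. neighbors D u = pverts D - {u})"
proof -
  interpret pair_fin_digraph D by fact
  let ?E = "{(u, v). (u, v) \<in> pverts D \<times> pverts D \<and> u \<noteq> v}"
  \<comment> \<open>The neighborhood condition only speaks of \<open>u\<close> in
    \<open>pverts D\<close>; this fact rules out arcs with an end elsewhere.\<close>
  have nb: "v \<in> pverts D" if "(u, v) \<in> parcs (mk_symmetric D) \<or> (v, u) \<in> parcs (mk_symmetric D)" for u v
    using that by (auto simp: parcs_mk_symmetric dest: in_arcsD1 in_arcsD2)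
  have "parcs (mk_symmetric D) = ?E \<longleftrightarrow> (\<forall>u\<in>pverts D. neighbors D u = pverts D - {u})"
  proof
    assume "parcs (mk_symmetric D) = ?E"
    then show "\<forall>u\<in>pverts D. neighbors D u = pverts D - {u}" by (auto simp: neighbors_def)
  next
    assume "\<forall>u\<in>pverts D. neighbors D u = pverts D - {u}"
    then have "(u, v) \<in> parcs (mk_symmetric D) \<longleftrightarrow> v \<in> pverts D - {u}" if "u \<in> pverts D" for u v
      using that by (auto simp: neighbors_def set_eq_iff)
    with nb show "parcs (mk_symmetric D) = ?E" by blast
  qed
  then show ?thesis by (simp add: complete_digraph_pair_def pair_finite_verts)
qed

text \<open>A loop is a cycle of length one.\<close>

lemma not_mem_neighbors_self:
  assumes "pair_fin_digraph D" "\<not> (\<exists>p. pre_digraph.cycle (with_proj D) p)"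
  shows "v \<notin> neighbors D v"
proof
  interpret pair_fin_digraph D by fact
  assume "v \<in> neighbors D v"
  then have "(v, v) \<in> parcs D" by (simp add: mem_neighbors_iff)
  then have "cycle [(v, v)]"
    by (auto simp: cycle_def awalk_def dest: in_arcsD1 intro!: exI[of _ v])
  then show False using assms(2) by blast
qed

text \<open>Without induced paths on three vertices, adjacency is transitive between distinct
  vertices, so any walk from \<open>u\<close> to another vertex shortens to a single edge, by
  induction along the walk.\<close>

lemma connected_neighbors_eq:
  assumes "pair_fin_digraph D" "Digraph_Component.connected (with_proj D)"
    and "\<And>v. v \<notin> neighbors D v"
    and trans: "\<And>a b c. b \<in> neighbors D a \<Longrightarrow> c \<in> neighbors D b \<Longrightarrow> a \<noteq> c \<Longrightarrow> c \<in> neighbors D a"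
    and "u \<in> pverts D"
  shows "neighbors D u = pverts D - {u}"
proof -
  interpret pair_fin_digraph D by fact
  interpret sym: pair_wf_digraph "mk_symmetric D" by (rule wellformed_mk_symmetric)
  have "v = u \<or> v \<in> neighbors D u" if "v \<in> pverts D" for v
  proof -
    have "u \<rightarrow>\<^sup>*\<^bsub>with_proj (mk_symmetric (with_proj D))\<^esub> v"
      using assms(2,5) that by (simp add: connected_def strongly_connected_def)
    then show ?thesis
    proof (induction rule: sym.reachable_induct)
      case (step x y)
      then have "y \<in> neighbors D x" by (simp add: neighbors_def)
      then show ?case using step trans by blast
    qed simp
  qed
  then show ?thesis using assms(3) neighbors_subset by blast
qed

lemma induced_path_not_totally_unimodular:
  assumes "pair_fin_digraph D"
    and ab: "b \<in> neighbors D a" and bc: "c \<in> neighbors D b"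
    and ac: "a \<noteq> c" "c \<notin> neighbors D a"
    and loopfree: "\<And>v. v \<notin> neighbors D v"
  shows "\<not> totally_unimodular (lp_constrs D) (lp_vars D) (lp_matrix D)"
proof
  interpret pair_fin_digraph D by fact
  assume tu: "totally_unimodular (lp_constrs D) (lp_vars D) (lp_matrix D)"
  \<comment> \<open>The edge may be oriented either way; reversing it only negates the arc
    row.\<close>
  obtain u v where uv: "(u, v) \<in> parcs D" "(u, v) = (a, b) \<or> (u, v) = (b, a)"
    using ab by (auto simp: mem_neighbors_iff)
  have verts: "a \<in> pverts D" "c \<in> pverts D"
    using ab bc by (auto simp: mem_neighbors_iff dest: in_arcsD1 in_arcsD2)
  \<comment> \<open>Both \<open>a\<close> and \<open>c\<close> are neighbors of \<open>b\<close> and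
    neither is a neighbor of \<open>a\<close>, so up to sign the rows are (1, 1, 0), (-1, 0, 1) and
    (0, -1, 1).\<close>
  let ?rs = "[Arc_constr (u, v), Vert_constr a, Vert_constr c]"
  let ?cs = "[Var_f a, Var_f c, Var_k]"
  have "det (mat (length ?rs) (length ?cs) (\<lambda>(i, j). lp_matrix D (?rs ! i) (?cs ! j))) \<in> {-1, 0, 1}"
    using tu uv(1) verts ac unfolding totally_unimodular_def
    by (elim allE[of _ ?rs] allE[of _ ?cs]) (auto simp: lp_constrs_def lp_vars_def)
  moreover have "length ?rs = 3" "length ?cs = 3" by simp_all
  moreover have "a \<in> neighbors D b" using ab by (auto simp: mem_neighbors_iff)
  ultimately show False
    using uv(2) ac ab bc loopfree by (auto simp only: det_3) auto
qed

theorem theorem1: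
  fixes D :: "'v pair_pre_digraph"
  assumes "pair_fin_digraph D"
    and "Digraph_Component.connected (with_proj D)"
    and "\<not> (\<exists>p. pre_digraph.cycle (with_proj D) p)"
  shows "totally_unimodular (lp_constrs D) (lp_vars D) (lp_matrix D) \<longleftrightarrow>
    complete_digraph (card (pverts D)) (with_proj (mk_symmetric (with_proj D)))"
proof -
  interpret pair_fin_digraph D by fact
  note loopfree = not_mem_neighbors_self[OF assms(1,3)]
  show ?thesis
    unfolding complete_mk_symmetric_iff[OF assms(1)]
  proof
    assume "totally_unimodular (lp_constrs D) (lp_vars D) (lp_matrix D)"
    \<comment> \<open>A failure of transitivity of adjacency is exactly an induced path, which total
      unimodularity excludes.\<close>
    then show "\<forall>u\<in>pverts D. neighbors D u = pverts D - {u}"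
      using connected_neighbors_eq[OF assms(1,2) loopfree]
        induced_path_not_totally_unimodular[OF assms(1) _ _ _ _ loopfree] by blast
  next
    assume nb: "\<forall>u\<in>pverts D. neighbors D u = pverts D - {u}"
    \<comment> \<open>The neighborhoods of \<open>u\<close> and \<open>v\<close> differ only in
      \<open>u\<close> and \<open>v\<close> themselves, which leaves 1 at \<open>u\<close> and -1 at
      \<open>v\<close>.\<close>
    have arc: "lp_matrix D (Arc_constr (u, v)) (Var_f x) = of_bool (x = u) - of_bool (x = v)"
      if "(u, v) \<in> parcs D" "x \<in> pverts D" for u v x
      using that nb by (auto dest: in_arcsD1 in_arcsD2)
    show "totally_unimodular (lp_constrs D) (lp_vars D) (lp_matrix D)"
      by (rule totally_unimodularI)
        (auto simp: lp_constrs_def lp_vars_def arc of_bool_def simp del: lp_matrix.simps(2)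
          split: if_splits)
  qed
qed

end
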